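(* Let $0<p<1$, $0<q<1$, let $L\ge1$ be an integer, and let $(X_k)_{k\ge0}$ be the perturbed at $L$-extrema random walk with parameters $p,q$ and $X_0=0$. Let $\Delta_L=(2p-1)\pi(\max)+(2q-1)\pi(\min)$, where $\pi(\max)$ and $\pi(\min)$ are the stationary probabilities of the sets of local maxima and of local minima for the associated Markov chain of the last $L$ increments. Then $$\lim_{n\to\infty}\frac{X_n}{n}=\Delta_L\quad\text{almost surely},$$ and hence, if $\Delta_L\neq0$, then $X_n$ is transient (that is, $|X_n|\to\infty$ almost surely).
   Context: The perturbed at $L$-extrema random walk (finite memory $L$): $(X_k)_{k\ge0}$ is a nearest-neighbour process on $\mathbb{Z}$ (each step is $\pm1$) such that, conditionally on the history $X_0,\dots,X_k$ with $X_k=x$, the probability that $X_{k+1}=x+1$ equals $p$ if $x=\max_{0\le m\le L\wedge k}X_{k-m}$, equals $q$ if $x=\min_{0\le m\le L\wedge k}X_{k-m}$, and equals $\tfrac12$ otherwise; $X_{k+1}=x-1$ with the complementary probability. If $x$ is both the maximum and the minimum (which happens only at $k=0$), the probability is $\tfrac12$. Increment chain: for $k\ge L$ let $Y_k=(\eta_k^1,\dots,\eta_k^L)$ with $\eta_k^i=X_{k-i+1}-X_{k-i}$. This is a Markov chain on $\{-1,+1\}^L$. For $\eta=(\eta^1,\dots,\eta^L)$ put $S(\eta,j)=\eta^1+\dots+\eta^j$; $\eta$ is a local maximum if $S(\eta,j)\ge0$ for all $j=1,\dots,L$, a local minimum if $S(\eta,j)\le0$ for all $j=1,\dots,L$, and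 "neither" otherwise. From $(\eta^1,\dots,\eta^L)$ the chain moves to $(\eta_*,\eta^1,\dots,\eta^{L-1})$, where $\eta_*=+1$ with probability $p$, $q$ or $\tfrac12$ according to whether $\eta$ is a local maximum, a local minimum, or neither, and $\eta_*=-1$ otherwise. The chain is irreducible on a finite state space; $\pi$ denotes its unique stationary distribution, and $\pi(\max)=\sum_{\eta\text{ local max}}\pi(\eta)$, $\pi(\min)=\sum_{\eta\text{ local min}}\pi(\eta)$. *)

theory Defs
  imports "HOL-Probability.Probability"
begin

definition recent :: "nat \<Rightarrow> (nat \<Rightarrow> int) \<Rightarrow> nat \<Rightarrow> int set" where
  "recent L x k = (\<lambda>m. x (k - m)) ` {0..min L k}"

definition walk_up_prob :: "nat \<Rightarrow> real \<Rightarrow> real \<Rightarrow> (nat \<Rightarrow> int) \<Rightarrow> nat \<Rightarrow> real" where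
  "walk_up_prob L p q x k =
     (if x k = Max (recent L x k) \<and> x k = Min (recent L x k) then 1/2
      else if x k = Max (recent L x k) then p
      else if x k = Min (recent L x k) then q
      else 1/2)"

text \<open>Only \<open>x 0, \<dots>, x k\<close> matter below; the function \<open>x\<close> encodes the observed history.
  The two conditional probabilities add up to 1, so almost surely every step is \<open>\<plusminus>1\<close>.\<close>

locale perturbed_walk = prob_space M
  for M :: "'a measure" and L :: nat and p q :: real and X :: "nat \<Rightarrow> 'a \<Rightarrow> int" +
  assumes X_measurable: "\<And>k. random_variable (count_space UNIV) (X k)"
    and step_up: "\<And>k x. \<P>(\<omega> in M. \<forall>i\<le>k. X i \<omega> = x i) > 0 \<Longrightarrow>
      \<P>(\<omega> in M. X (Suc k) \<omega> = x k + 1 \<bar> \<forall>i\<le>k. X i \<omega> = x i) = walk_up_prob L p q x k"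
    and step_down: "\<And>k x. \<P>(\<omega> in M. \<forall>i\<le>k. X i \<omega> = x i) > 0 \<Longrightarrow>
      \<P>(\<omega> in M. X (Suc k) \<omega> = x k - 1 \<bar> \<forall>i\<le>k. X i \<omega> = x i) = 1 - walk_up_prob L p q x k"

text \<open>Increment vectors \<open>(\<eta>\<^sup>1, \<dots>, \<eta>\<^sup>L)\<close> are lists with the most recent increment first,
  so a partial sum of the first \<open>j\<close> entries is \<open>X k - X (k - j)\<close> and a step of the chain drops the last entry.\<close>

definition incr_states :: "nat \<Rightarrow> int list set" where
  "incr_states L = {\<eta>. length \<eta> = L \<and> set \<eta> \<subseteq> {-1, 1}}"

definition partial_sum :: "int list \<Rightarrow> nat \<Rightarrow> int" where
  "partial_sum \<eta> j = sum_list (take j \<eta>)"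

definition local_max :: "int list \<Rightarrow> bool" where
  "local_max \<eta> \<longleftrightarrow> (\<forall>j\<in>{1..length \<eta>}. partial_sum \<eta> j \<ge> 0)"

definition local_min :: "int list \<Rightarrow> bool" where
  "local_min \<eta> \<longleftrightarrow> (\<forall>j\<in>{1..length \<eta>}. partial_sum \<eta> j \<le> 0)"

definition incr_up_prob :: "real \<Rightarrow> real \<Rightarrow> int list \<Rightarrow> real" where
  "incr_up_prob p q \<eta> = (if local_max \<eta> then p else if local_min \<eta> then q else 1/2)"

definition incr_kernel :: "real \<Rightarrow> real \<Rightarrow> int list \<Rightarrow> int list pmf" where
  "incr_kernel p q \<eta> =
     map_pmf (\<lambda>b. (if b then 1 else -1) # butlast \<eta>) (bernoulli_pmf (incr_up_prob p q \<eta>))"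

definition incr_stationary :: "nat \<Rightarrow> real \<Rightarrow> real \<Rightarrow> int list pmf \<Rightarrow> bool" where
  "incr_stationary L p q \<pi> \<longleftrightarrow>
     set_pmf \<pi> \<subseteq> incr_states L \<and> bind_pmf \<pi> (incr_kernel p q) = \<pi>"

definition stationary_dist :: "nat \<Rightarrow> real \<Rightarrow> real \<Rightarrow> int list pmf" where
  "stationary_dist L p q = (THE \<pi>. incr_stationary L p q \<pi>)"

definition pi_max :: "nat \<Rightarrow> real \<Rightarrow> real \<Rightarrow> real" where
  "pi_max L p q = (\<Sum>\<eta> | \<eta> \<in> incr_states L \<and> local_max \<eta>. pmf (stationary_dist L p q) \<eta>)"

definition pi_min :: "nat \<Rightarrow> real \<Rightarrow> real \<Rightarrow> real" where
  "pi_min L p q = (\<Sum>\<eta> | \<eta> \<in> incr_states L \<and> local_min \<eta>. pmf (stationary_dist L p q) \<eta>)"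

definition drift :: "nat \<Rightarrow> real \<Rightarrow> real \<Rightarrow> real" where
  "drift L p q = (2 * p - 1) * pi_max L p q + (2 * q - 1) * pi_min L p q"

end

theory Submission
  imports Defs "HOL-Library.Discrete_Functions"
begin

text \<open>
  By Doeblin's minorisation the increment chain contracts oscillations geometrically, so the
  averages of every observable converge to a constant, which is its stationary mean, and the Poisson
  equation \<open>g - T g = f - \<pi> f\<close> is solved by a convergent series. For \<open>f = 2 up - 1\<close>, the mean of the
  next step, \<open>\<pi> f\<close> is the drift and \<open>X n - n * drift + g (Y n)\<close> is a martingale with bounded
  increments. Its second moment grows at most linearly, so it is \<open>o(n)\<close> almost surely: along the
  squares because the second moments of \<open>Z (n\<^sup>2) / n\<^sup>2\<close> are summable, and in between by the bound on
  the increments.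
\<close>

section \<open>Ergodicity of the increment chain\<close>

lemma finite_incr_states: "finite (incr_states n)"
  using finite_lists_length_eq[of "{-1, 1::int}" n] unfolding incr_states_def
  by (simp add: conj_commute)

lemma incr_states_0: "incr_states 0 = {[]}"
  by (auto simp: incr_states_def)

lemma incr_states_Cons: "s # e \<in> incr_states (Suc n) \<longleftrightarrow> s \<in> {-1, 1} \<and> e \<in> incr_states n"
  by (auto simp: incr_states_def)

lemma sum_incr_states_Suc:
  "(\<Sum>e\<in>incr_states (Suc n). \<phi> e) = (\<Sum>e\<in>incr_states n. \<phi> (1 # e) + \<phi> (- 1 # e))"
  for \<phi> :: "int list \<Rightarrow> real"
proof -
  have eq: "incr_states (Suc n) = (#) 1 ` incr_states n \<union> (#) (- 1) ` incr_states n"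
  proof (intro equalityI subsetI)
    fix e assume "e \<in> incr_states (Suc n)"
    then show "e \<in> (#) 1 ` incr_states n \<union> (#) (- 1) ` incr_states n"
      by (cases e) (auto simp: incr_states_def)
  qed (auto simp: incr_states_def)
  have "(\<Sum>e\<in>incr_states (Suc n). \<phi> e) = sum \<phi> ((#) 1 ` incr_states n) + sum \<phi> ((#) (- 1) ` incr_states n)"
    unfolding eq using finite_incr_states by (intro sum.union_disjoint finite_imageI) auto
  then show ?thesis
    by (simp add: sum.reindex sum.distrib)
qed

section \<open>The averaging operator of the increment chain\<close>

locale incr_chain =
  fixes L :: nat and p q :: real
  assumes p: "0 < p" "p < 1" and q: "0 < q" "q < 1" and L: "1 \<le> L"
begin

abbreviation S :: "int list set" where "S \<equiv> incr_states L"

abbreviation up :: "int list \<Rightarrow> real" where "up \<equiv> incr_up_prob p q"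

text \<open>The transition operator of the chain, written as a two-term average;
  \<open>T_eq_expectation\<close> links it to \<open>incr_kernel\<close>.\<close>

definition T :: "(int list \<Rightarrow> real) \<Rightarrow> int list \<Rightarrow> real" where
  "T h \<eta> = up \<eta> * h (1 # butlast \<eta>) + (1 - up \<eta>) * h (- 1 # butlast \<eta>)"

text \<open>A lower bound for the probability of either step from any state; \<open>1 / 2\<close>
  covers the states that are neither local maxima nor local minima.\<close>

definition \<epsilon> :: real where "\<epsilon> = Min {p, 1 - p, q, 1 - q, 1 / 2}"

lemma eps_pos: "0 < \<epsilon>" and eps_less_1: "\<epsilon> < 1" and eps_le_up: "\<epsilon> \<le> up \<eta>" "\<epsilon> \<le> 1 - up \<eta>"
  using p q unfolding \<epsilon>_def incr_up_prob_def by (auto simp: min_def)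

lemma up_bounds: "0 \<le> up \<eta>" "up \<eta> \<le> 1"
  using eps_le_up[of \<eta>] eps_pos by auto

lemma shift_in_S: "s \<in> {-1, 1} \<Longrightarrow> \<eta> \<in> S \<Longrightarrow> s # butlast \<eta> \<in> S"
  using L unfolding incr_states_def by (auto dest: in_set_butlastD)

lemma ones_in_S: "replicate L 1 \<in> S"
  unfolding incr_states_def by auto

lemma S_nonempty: "S \<noteq> {}"
  using ones_in_S by auto

lemma T_mono:
  assumes "\<And>\<zeta>. \<zeta> \<in> S \<Longrightarrow> h \<zeta> \<le> h' \<zeta>" "\<eta> \<in> S"
  shows "T h \<eta> \<le> T h' \<eta>"
  unfolding T_def using assms up_bounds[of \<eta>] shift_in_S[OF _ assms(2)]
  by (intro add_mono mult_left_mono) auto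

lemma T_const [simp]: "T (\<lambda>_. a) = (\<lambda>_. a)"
  unfolding T_def by (auto simp: algebra_simps)

lemma T_pow_const [simp]: "(T ^^ n) (\<lambda>_. a) = (\<lambda>_. a)"
  by (induction n) auto

lemma T_pow_mono:
  assumes "\<And>\<zeta>. \<zeta> \<in> S \<Longrightarrow> h \<zeta> \<le> h' \<zeta>" "\<eta> \<in> S"
  shows "(T ^^ n) h \<eta> \<le> (T ^^ n) h' \<eta>"
  using assms by (induction n arbitrary: \<eta>) (auto intro: T_mono)

text \<open>A step from \<open>S\<close> stays in \<open>S\<close>, so values outside
  \<open>S\<close> never enter.\<close>

lemma T_pow_cong:
  assumes "\<And>\<zeta>. \<zeta> \<in> S \<Longrightarrow> h \<zeta> = h' \<zeta>" "\<eta> \<in> S"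
  shows "(T ^^ n) h \<eta> = (T ^^ n) h' \<eta>"
  using T_pow_mono[of h h' \<eta> n] T_pow_mono[of h' h \<eta> n] assms by fastforce

lemma T_sum:
  "T (\<lambda>\<zeta>. \<Sum>i\<in>I. a i * h i \<zeta>) = (\<lambda>\<eta>. \<Sum>i\<in>I. a i * T (h i) \<eta>)"
  unfolding T_def by (simp add: sum_distrib_left distrib_left sum.distrib mult_ac)

lemma T_pow_sum:
  "(T ^^ n) (\<lambda>\<zeta>. \<Sum>i\<in>I. a i * h i \<zeta>) = (\<lambda>\<eta>. \<Sum>i\<in>I. a i * (T ^^ n) (h i) \<eta>)"
  by (induction n) (simp_all add: T_sum)

lemma T_pow_uminus: "(T ^^ n) (\<lambda>\<zeta>. - h \<zeta>) \<eta> = - (T ^^ n) h \<eta>"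
  using T_pow_sum[of n "\<lambda>_. -1" "\<lambda>_. h" "{()}"] by (simp add: fun_eq_iff)

text \<open>Doeblin's minorisation: the path that appends \<open>+1\<close> only reaches the all-ones state within
  \<open>L\<close> steps, and each of its steps has probability at least \<open>\<epsilon>\<close>.\<close>

lemma T_pow_lower:
  assumes h: "\<And>\<zeta>. \<zeta> \<in> S \<Longrightarrow> a \<le> h \<zeta>" and \<eta>: "\<eta> \<in> S" and j: "j \<le> L"
    and "take (L - j) \<eta> = replicate (L - j) 1"
  shows "a + \<epsilon> ^ j * (h (replicate L 1) - a) \<le> (T ^^ j) h \<eta>"
  using \<eta> j assms(4)
proof (induction j arbitrary: \<eta>)
  case 0
  then have "\<eta> = replicate L 1"
    by (simp add: incr_states_def)
  then show ?case by simp
next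
  case (Suc j)
  let ?d = "h (replicate L 1) - a"
  have d: "0 \<le> ?d" using h[OF ones_in_S] by simp
  \<comment> \<open>Appending \<open>+1\<close> lengthens the initial run of ones by one.\<close>
  have "take (L - j) (1 # butlast \<eta>) = replicate (L - j) 1"
  proof -
    have "L - j = Suc (L - Suc j)" using Suc.prems by simp
    moreover have "take (L - Suc j) (butlast \<eta>) = take (L - Suc j) \<eta>"
      using Suc.prems by (simp add: take_butlast incr_states_def)
    ultimately show ?thesis using Suc.prems by simp
  qed
  then have 1: "a + \<epsilon> ^ j * ?d \<le> (T ^^ j) h (1 # butlast \<eta>)"
    using Suc shift_in_S[of 1 \<eta>] by simp
  \<comment> \<open>The branch that appends \<open>-1\<close> contributes only the trivial bound
    \<open>a\<close>.\<close>
  have 2: "a \<le> (T ^^ j) h (-1 # butlast \<eta>)"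
    using T_pow_mono[of "\<lambda>_. a" h "-1 # butlast \<eta>" j] h shift_in_S[of "-1" \<eta>] Suc.prems by simp
  have "a + \<epsilon> * (\<epsilon> ^ j * ?d) \<le> a + up \<eta> * (\<epsilon> ^ j * ?d)"
    using eps_le_up eps_pos d by (intro add_left_mono mult_right_mono) auto
  also have "\<dots> = up \<eta> * (a + \<epsilon> ^ j * ?d) + (1 - up \<eta>) * a"
    by (simp add: algebra_simps)
  also have "\<dots> \<le> T ((T ^^ j) h) \<eta>"
    unfolding T_def[of "(T ^^ j) h"] using 1 2 up_bounds[of \<eta>] by (intro add_mono mult_left_mono) auto
  finally show ?case by (simp add: mult.assoc)
qed

section \<open>Decay of oscillation and the ergodic limit\<close>

definition lo :: "(int list \<Rightarrow> real) \<Rightarrow> nat \<Rightarrow> real" where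
  "lo h n = Min ((T ^^ n) h ` S)"

definition hi :: "(int list \<Rightarrow> real) \<Rightarrow> nat \<Rightarrow> real" where
  "hi h n = Max ((T ^^ n) h ` S)"

lemma lo_le: "\<eta> \<in> S \<Longrightarrow> lo h n \<le> (T ^^ n) h \<eta>"
  and le_hi: "\<eta> \<in> S \<Longrightarrow> (T ^^ n) h \<eta> \<le> hi h n"
  unfolding lo_def hi_def using finite_incr_states by auto

text \<open>Averages stay within the range of what is averaged, so the intervals from
  \<open>lo h n\<close> to \<open>hi h n\<close> are nested.\<close>

lemma T_pow_between:
  assumes "\<eta> \<in> S" "m \<le> n"
  shows "lo h m \<le> (T ^^ n) h \<eta>" "(T ^^ n) h \<eta> \<le> hi h m"
proof -
  have *: "(T ^^ n) h \<eta> = (T ^^ (n - m)) ((T ^^ m) h) \<eta>"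
    using assms(2) by (metis comp_apply funpow_add le_add_diff_inverse2)
  show "lo h m \<le> (T ^^ n) h \<eta>" "(T ^^ n) h \<eta> \<le> hi h m"
    using T_pow_mono[of "\<lambda>_. lo h m" "(T ^^ m) h" \<eta> "n - m"]
      T_pow_mono[of "(T ^^ m) h" "\<lambda>_. hi h m" \<eta> "n - m"] assms(1) lo_le le_hi
    unfolding * by auto
qed

lemma lo_le_hi: "lo h n \<le> hi h n"
  using lo_le[OF ones_in_S] le_hi[OF ones_in_S] by (rule order_trans)

text \<open>For \<open>j = L\<close> the prefix condition of \<open>T_pow_lower\<close> is vacuous.
  Applied to \<open>(T ^^ n) h\<close> and to its negative, it moves both ends of the range towards
  the value at the all-ones state; the two gains add up to \<open>\<epsilon> ^ L\<close> times the
  oscillation, whatever that value is.\<close>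

lemma osc_contract: "hi h (n + L) - lo h (n + L) \<le> (1 - \<epsilon> ^ L) * (hi h n - lo h n)"
proof -
  let ?k = "(T ^^ n) h" and ?o = "replicate L (1::int)"
  have *: "(T ^^ (n + L)) h = (T ^^ L) ?k"
    by (metis comp_apply funpow_add add.commute)
  have "lo h n + \<epsilon> ^ L * (?k ?o - lo h n) \<le> (T ^^ (n + L)) h \<eta>" if "\<eta> \<in> S" for \<eta>
    unfolding * using T_pow_lower[of "lo h n" ?k \<eta> L] that lo_le by simp
  then have 1: "lo h n + \<epsilon> ^ L * (?k ?o - lo h n) \<le> lo h (n + L)"
    unfolding lo_def[of h "n + L"] using finite_incr_states S_nonempty by simp
  have "(T ^^ (n + L)) h \<eta> \<le> hi h n - \<epsilon> ^ L * (hi h n - ?k ?o)" if "\<eta> \<in> S" for \<eta>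
    unfolding * using T_pow_lower[of "- hi h n" "\<lambda>\<zeta>. - ?k \<zeta>" \<eta> L] that le_hi
    by (simp add: T_pow_uminus algebra_simps)
  then have 2: "hi h (n + L) \<le> hi h n - \<epsilon> ^ L * (hi h n - ?k ?o)"
    unfolding hi_def[of h "n + L"] using finite_incr_states S_nonempty by simp
  from 1 2 show ?thesis by (simp add: algebra_simps)
qed

text \<open>Splitting off the first \<open>L\<close> terms and contracting the others bounds each
  partial sum by a constant plus \<open>1 - \<epsilon> ^ L\<close> times itself.\<close>

lemma summable_osc: "summable (\<lambda>n. hi h n - lo h n)"
proof (rule summableI_nonneg_bounded)
  let ?w = "\<lambda>n. hi h n - lo h n" and ?\<delta> = "\<epsilon> ^ L"
  show "0 \<le> ?w n" for n using lo_le_hi by simp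
  have \<delta>: "0 < ?\<delta>" "?\<delta> \<le> 1"
    using eps_pos eps_less_1 by (auto intro: power_le_one)
  show "sum ?w {..<N} \<le> sum ?w {..<L} / ?\<delta>" for N
  proof -
    have "sum ?w {..<N} \<le> sum ?w {..<L + N}"
      using lo_le_hi by (intro sum_mono2) auto
    also have "\<dots> = sum ?w {..<L} + sum ?w {L..<L + N}"
      by (metis lessThan_atLeast0 le_add1 sum.atLeastLessThan_concat zero_le)
    also have "sum ?w {L..<L + N} = (\<Sum>n<N. ?w (n + L))"
      using sum.shift_bounds_nat_ivl[of ?w 0 L N] by (simp add: lessThan_atLeast0 add.commute)
    also have "(\<Sum>n<N. ?w (n + L)) \<le> (\<Sum>n<N. (1 - ?\<delta>) * ?w n)"
      using osc_contract by (intro sum_mono)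
    finally have "sum ?w {..<N} \<le> sum ?w {..<L} + (1 - ?\<delta>) * sum ?w {..<N}"
      by (simp only: sum_distrib_left[symmetric])
    then have "?\<delta> * sum ?w {..<N} \<le> sum ?w {..<L}"
      by (simp only: left_diff_distrib)
    with \<delta> show ?thesis by (simp add: field_simps)
  qed
qed

text \<open>By \<open>tendsto_erg\<close> the limit is the same from every state of
  \<open>S\<close>; the all-ones state is a fixed representative.\<close>

definition erg :: "(int list \<Rightarrow> real) \<Rightarrow> real" where
  "erg h = lim (\<lambda>n. (T ^^ n) h (replicate L 1))"

lemma T_pow_diff:
  assumes "\<eta> \<in> S" "\<eta>' \<in> S" "n \<le> m"
  shows "\<bar>(T ^^ m) h \<eta>' - (T ^^ n) h \<eta>\<bar> \<le> hi h n - lo h n"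
  using T_pow_between[OF assms(1) order_refl[of n], where h = h] T_pow_between[OF assms(2,3), where h = h] by linarith

lemma osc_tendsto_0: "(\<lambda>n. hi h n - lo h n) \<longlonglongrightarrow> 0"
  using summable_LIMSEQ_zero[OF summable_osc] .

lemma tendsto_erg_ones: "(\<lambda>n. (T ^^ n) h (replicate L 1)) \<longlonglongrightarrow> erg h"
proof -
  have "Cauchy (\<lambda>n. (T ^^ n) h (replicate L 1))"
  proof (rule metric_CauchyI)
    fix e :: real assume "0 < e"
    then obtain N where N: "hi h N - lo h N < e / 2"
      using order_tendstoD(2)[OF osc_tendsto_0[of h], of "e/2"] by (auto simp: eventually_sequentially)
    have "dist ((T ^^ m) h (replicate L 1)) ((T ^^ n) h (replicate L 1)) < e" if "N \<le> m" "N \<le> n" for m n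
      using T_pow_diff[OF ones_in_S ones_in_S that(1), of h] T_pow_diff[OF ones_in_S ones_in_S that(2), of h] N
      unfolding dist_real_def by linarith
    then show "\<exists>N. \<forall>m\<ge>N. \<forall>n\<ge>N. dist ((T ^^ m) h (replicate L 1)) ((T ^^ n) h (replicate L 1)) < e"
      by blast
  qed
  then show ?thesis
    unfolding erg_def by (simp add: Cauchy_convergent_iff convergent_LIMSEQ_iff)
qed

text \<open>Let the later index in \<open>T_pow_diff\<close> tend to infinity. The bound is
  summable, which makes the Poisson series converge.\<close>

lemma T_pow_erg:
  assumes "\<eta> \<in> S"
  shows "\<bar>(T ^^ n) h \<eta> - erg h\<bar> \<le> hi h n - lo h n"
proof (rule LIMSEQ_le_const2)
  show "(\<lambda>m. \<bar>(T ^^ n) h \<eta> - (T ^^ m) h (replicate L 1)\<bar>) \<longlonglongrightarrow> \<bar>(T ^^ n) h \<eta> - erg h\<bar>"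
    by (intro tendsto_intros tendsto_erg_ones)
  show "\<exists>N. \<forall>m\<ge>N. \<bar>(T ^^ n) h \<eta> - (T ^^ m) h (replicate L 1)\<bar> \<le> hi h n - lo h n"
    using T_pow_diff[OF assms ones_in_S, of n _ h] by (auto simp: abs_minus_commute)
qed

lemma tendsto_erg:
  assumes "\<eta> \<in> S"
  shows "(\<lambda>n. (T ^^ n) h \<eta>) \<longlonglongrightarrow> erg h"
  using Lim_null_comparison[OF _ osc_tendsto_0[of h], of "\<lambda>n. (T ^^ n) h \<eta> - erg h"] T_pow_erg[OF assms]
  by (auto simp: LIM_zero_iff)

text \<open>Only meaningful on \<open>S\<close>, where the series converges.\<close>

definition poisson :: "(int list \<Rightarrow> real) \<Rightarrow> int list \<Rightarrow> real" where
  "poisson h \<eta> = (\<Sum>n. (T ^^ n) h \<eta> - erg h)"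

lemma summable_poisson: "\<eta> \<in> S \<Longrightarrow> summable (\<lambda>n. (T ^^ n) h \<eta> - erg h)"
  by (rule summable_comparison_test'[OF summable_osc[of h], of 0]) (simp add: T_pow_erg)

text \<open>\<open>T\<close> acts on the series term by term and shifts it by one index, so the
  difference is the zeroth term.\<close>

lemma poisson_equation:
  assumes "\<eta> \<in> S"
  shows "poisson h \<eta> - T (poisson h) \<eta> = h \<eta> - erg h"
proof -
  let ?d = "\<lambda>\<eta> n. (T ^^ n) h \<eta> - erg h"
  have s: "?d \<zeta> sums poisson h \<zeta>" if "\<zeta> \<in> S" for \<zeta>
    unfolding poisson_def using summable_poisson[OF that] by (rule summable_sums)
  have "(\<lambda>n. up \<eta> * ?d (1 # butlast \<eta>) n + (1 - up \<eta>) * ?d (- 1 # butlast \<eta>) n) sums T (poisson h) \<eta>"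
    unfolding T_def[of "poisson h"] by (intro sums_add sums_mult s shift_in_S assms) auto
  also have "(\<lambda>n. up \<eta> * ?d (1 # butlast \<eta>) n + (1 - up \<eta>) * ?d (- 1 # butlast \<eta>) n) = (\<lambda>n. ?d \<eta> (Suc n))"
    by (simp add: T_def algebra_simps fun_eq_iff)
  finally have "?d \<eta> sums (T (poisson h) \<eta> + ?d \<eta> 0)"
    by (subst (asm) sums_Suc_iff) simp
  from sums_unique2[OF this s[OF assms]] show ?thesis by simp
qed

section \<open>The stationary distribution and its means\<close>

lemma T_eq_expectation: "T h \<eta> = measure_pmf.expectation (incr_kernel p q \<eta>) h"
  unfolding T_def incr_kernel_def using up_bounds[of \<eta>] by simp

lemma pmf_kernel: "pmf (incr_kernel p q \<eta>) \<zeta> = T (\<lambda>\<xi>. of_bool (\<xi> = \<zeta>)) \<eta>"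
proof -
  have "(\<lambda>\<xi>. of_bool (\<xi> = \<zeta>) :: real) = indicator {\<zeta>}"
    by (auto simp: indicator_def)
  then show ?thesis
    unfolding T_eq_expectation by (simp add: pmf.rep_eq)
qed

lemma pmf_bind_kernel:
  assumes "set_pmf \<pi> \<subseteq> S"
  shows "pmf (bind_pmf \<pi> (incr_kernel p q)) \<zeta> = (\<Sum>\<eta>\<in>S. pmf \<pi> \<eta> * T (\<lambda>\<xi>. of_bool (\<xi> = \<zeta>)) \<eta>)"
  unfolding pmf_bind pmf_kernel using assms finite_incr_states
  by (subst integral_measure_pmf[of S]) auto

text \<open>Stationarity gives the case of indicators of points; a general \<open>h\<close> is on
  \<open>S\<close> a linear combination of these.\<close>

lemma stationary_sum_T:
  assumes "incr_stationary L p q \<pi>"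
  shows "(\<Sum>\<eta>\<in>S. pmf \<pi> \<eta> * T h \<eta>) = (\<Sum>\<eta>\<in>S. pmf \<pi> \<eta> * h \<eta>)"
proof -
  have S: "set_pmf \<pi> \<subseteq> S" and b: "bind_pmf \<pi> (incr_kernel p q) = \<pi>"
    using assms unfolding incr_stationary_def by auto
  have "(\<Sum>\<zeta>\<in>S. pmf \<pi> \<zeta> * h \<zeta>) = (\<Sum>\<zeta>\<in>S. (\<Sum>\<eta>\<in>S. pmf \<pi> \<eta> * T (\<lambda>\<xi>. of_bool (\<xi> = \<zeta>)) \<eta>) * h \<zeta>)"
    unfolding pmf_bind_kernel[OF S, unfolded b, symmetric] ..
  also have "\<dots> = (\<Sum>\<eta>\<in>S. pmf \<pi> \<eta> * (\<Sum>\<zeta>\<in>S. h \<zeta> * T (\<lambda>\<xi>. of_bool (\<xi> = \<zeta>)) \<eta>))"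
    unfolding sum_distrib_right sum_distrib_left by (subst sum.swap) (simp add: mult_ac)
  also have "\<dots> = (\<Sum>\<eta>\<in>S. pmf \<pi> \<eta> * T h \<eta>)"
  proof (intro sum.cong refl arg_cong2[of _ _ _ _ "(*)"])
    fix \<eta> assume \<eta>: "\<eta> \<in> S"
    have "(\<Sum>\<zeta>\<in>S. h \<zeta> * T (\<lambda>\<xi>. of_bool (\<xi> = \<zeta>)) \<eta>) = T (\<lambda>\<xi>. \<Sum>\<zeta>\<in>S. h \<zeta> * of_bool (\<xi> = \<zeta>)) \<eta>"
      using T_sum[of h "\<lambda>\<zeta> \<xi>. of_bool (\<xi> = \<zeta>)" S] by (simp add: fun_eq_iff)
    also have "\<dots> = T h \<eta>"
      using T_pow_cong[of "\<lambda>\<xi>. \<Sum>\<zeta>\<in>S. h \<zeta> * of_bool (\<xi> = \<zeta>)" h \<eta> 1] \<eta> finite_incr_states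
      by (simp add: of_bool_def if_distrib[of "\<lambda>x. h _ * x"] cong: if_cong)
    finally show "(\<Sum>\<zeta>\<in>S. h \<zeta> * T (\<lambda>\<xi>. of_bool (\<xi> = \<zeta>)) \<eta>) = T h \<eta>" .
  qed
  finally show ?thesis by simp
qed

text \<open>The stationary mean of \<open>(T ^^ n) h\<close> does not depend on \<open>n\<close>,
  while \<open>(T ^^ n) h\<close> tends to the constant \<open>erg h\<close> on
  \<open>S\<close>.\<close>

lemma stationary_sum_erg:
  assumes "incr_stationary L p q \<pi>"
  shows "(\<Sum>\<eta>\<in>S. pmf \<pi> \<eta> * h \<eta>) = erg h"
proof -
  have "(\<Sum>\<eta>\<in>S. pmf \<pi> \<eta> * (T ^^ n) h \<eta>) = (\<Sum>\<eta>\<in>S. pmf \<pi> \<eta> * h \<eta>)" for n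
    by (induction n) (simp_all add: stationary_sum_T[OF assms])
  moreover have "(\<lambda>n. \<Sum>\<eta>\<in>S. pmf \<pi> \<eta> * (T ^^ n) h \<eta>) \<longlonglongrightarrow> (\<Sum>\<eta>\<in>S. pmf \<pi> \<eta> * erg h)"
    by (intro tendsto_intros tendsto_erg)
  moreover have "(\<Sum>\<eta>\<in>S. pmf \<pi> \<eta>) = 1"
    using assms finite_incr_states unfolding incr_stationary_def by (intro sum_pmf_eq_1) auto
  ultimately show ?thesis
    by (simp add: sum_distrib_right[symmetric] LIMSEQ_const_iff)
qed

text \<open>The mass of \<open>\<zeta>\<close> is its limiting probability, \<open>erg\<close> of
  its indicator. As \<open>erg\<close> is linear, these masses sum to \<open>erg\<close> of the
  constant 1, and stationarity becomes \<open>erg (T h) = erg h\<close>.\<close>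

lemma ex_stationary: "\<exists>\<pi>. incr_stationary L p q \<pi>"
proof -
  let ?i = "\<lambda>\<zeta> \<xi>. of_bool (\<xi> = (\<zeta>::int list)) :: real"
  let ?w = "\<lambda>\<zeta>. if \<zeta> \<in> S then erg (?i \<zeta>) else 0"
  let ?o = "replicate L (1::int)"
  have sum_erg: "(\<lambda>n. (T ^^ n) (\<lambda>\<xi>. \<Sum>\<zeta>\<in>S. a \<zeta> * ?i \<zeta> \<xi>) ?o) \<longlonglongrightarrow> (\<Sum>\<zeta>\<in>S. a \<zeta> * erg (?i \<zeta>))" for a
    unfolding T_pow_sum by (intro tendsto_intros tendsto_erg ones_in_S)
  \<comment> \<open>On \<open>S\<close> every observable is the sum of its values times
    indicators.\<close>
  have expand: "(T ^^ n) (\<lambda>\<xi>. \<Sum>\<zeta>\<in>S. a \<zeta> * ?i \<zeta> \<xi>) ?o = (T ^^ n) a ?o" for a n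
    using finite_incr_states by (intro T_pow_cong ones_in_S)
      (simp add: of_bool_def if_distrib[of "\<lambda>x. a _ * x"] cong: if_cong)
  have erg_sum: "(\<Sum>\<zeta>\<in>S. a \<zeta> * erg (?i \<zeta>)) = erg a" for a
    using LIMSEQ_unique[OF sum_erg[of a]] tendsto_erg[OF ones_in_S, of a] unfolding expand by blast
  have nn: "0 \<le> ?w \<zeta>" for \<zeta>
    using T_pow_mono[of "\<lambda>_. 0" "?i \<zeta>", OF _ ones_in_S]
    by (auto intro!: LIMSEQ_le_const[OF tendsto_erg[OF ones_in_S]])
  have "erg (\<lambda>_. 1) = 1"
    unfolding erg_def by (simp add: limI)
  then have one: "(\<Sum>\<zeta>\<in>S. ?w \<zeta>) = 1"
    using erg_sum[of "\<lambda>_. 1"] by simp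
  have "(\<integral>\<^sup>+ \<zeta>. ennreal (?w \<zeta>) \<partial>count_space UNIV) = (\<integral>\<^sup>+ \<zeta>. ennreal (?w \<zeta>) \<partial>count_space S)"
    by (subst nn_integral_count_space_indicator) (auto intro!: nn_integral_cong simp: indicator_def)
  also have "\<dots> = ennreal (\<Sum>\<zeta>\<in>S. ?w \<zeta>)"
    by (simp only: nn_integral_count_space_finite[OF finite_incr_states] sum_ennreal[OF nn])
  finally have prob: "(\<integral>\<^sup>+ \<zeta>. ennreal (?w \<zeta>) \<partial>count_space UNIV) = 1"
    unfolding one by simp
  define \<pi> where "\<pi> = embed_pmf ?w"
  have pmf: "pmf \<pi> \<zeta> = ?w \<zeta>" for \<zeta>
    unfolding \<pi>_def using nn prob by (rule pmf_embed_pmf)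
  have S: "set_pmf \<pi> \<subseteq> S"
    by (auto simp: set_pmf_iff pmf split: if_splits)
  have "pmf (bind_pmf \<pi> (incr_kernel p q)) \<zeta> = pmf \<pi> \<zeta>" for \<zeta>
  proof -
    have "pmf (bind_pmf \<pi> (incr_kernel p q)) \<zeta> = (\<Sum>\<eta>\<in>S. T (?i \<zeta>) \<eta> * erg (?i \<eta>))"
      unfolding pmf_bind_kernel[OF S] by (simp add: pmf mult.commute)
    also have "\<dots> = erg (T (?i \<zeta>))"
      by (rule erg_sum)
    also have "\<dots> = erg (?i \<zeta>)"
    \<comment> \<open>Both are limits of the same sequence, shifted by one index.\<close>
    proof (rule LIMSEQ_unique[OF tendsto_erg[OF ones_in_S]])
      show "(\<lambda>n. (T ^^ n) (T (?i \<zeta>)) ?o) \<longlonglongrightarrow> erg (?i \<zeta>)"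
        using LIMSEQ_Suc[OF tendsto_erg[OF ones_in_S, of "?i \<zeta>"]]
        by (simp only: funpow_Suc_right comp_apply)
    qed
    also have "\<dots> = pmf \<pi> \<zeta>"
    proof (cases "\<zeta> \<in> S")
      \<comment> \<open>The indicator of a point outside \<open>S\<close> vanishes on
        \<open>S\<close>, which agrees with the cut-off in \<open>?w\<close>.\<close>
      case False
      then have "(T ^^ n) (?i \<zeta>) ?o = (T ^^ n) (\<lambda>_. 0) ?o" for n
        by (intro T_pow_cong ones_in_S) auto
      then show ?thesis
        using False by (simp add: pmf erg_def limI)
    qed (simp add: pmf)
    finally show ?thesis .
  qed
  then have "bind_pmf \<pi> (incr_kernel p q) = \<pi>"
    by (rule pmf_eqI)
  with S show ?thesis
    unfolding incr_stationary_def by blast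
qed

text \<open>Uniqueness: \<open>stationary_sum_erg\<close> applied to indicators determines every
  point mass in \<open>S\<close>.\<close>

lemma stationary_dist: "incr_stationary L p q (stationary_dist L p q)"
  unfolding stationary_dist_def
proof (rule theI')
  have "\<pi> = \<pi>'" if s: "incr_stationary L p q \<pi>" "incr_stationary L p q \<pi>'" for \<pi> \<pi>'
  proof (rule pmf_eqI)
    fix \<zeta>
    show "pmf \<pi> \<zeta> = pmf \<pi>' \<zeta>"
    proof (cases "\<zeta> \<in> S")
      case True
      then show ?thesis
        using stationary_sum_erg[OF s(1), of "\<lambda>\<xi>. of_bool (\<xi> = \<zeta>)"]
          stationary_sum_erg[OF s(2), of "\<lambda>\<xi>. of_bool (\<xi> = \<zeta>)"] finite_incr_states
        by (simp add: of_bool_def if_distrib[of "\<lambda>x. pmf _ _ * x"] cong: if_cong)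
    next
      case False
      then show ?thesis
        using s unfolding incr_stationary_def by (metis pmf_eq_0_set_pmf subsetD)
    qed
  qed
  then show "\<exists>!\<pi>. incr_stationary L p q \<pi>"
    using ex_stationary by blast
qed

text \<open>The first partial sum is the newest increment, which is not 0.\<close>

lemma not_max_and_min:
  assumes "\<eta> \<in> S"
  shows "\<not> (local_max \<eta> \<and> local_min \<eta>)"
proof -
  obtain s \<eta>' where "\<eta> = s # \<eta>'" "s \<in> {-1, 1}"
    using assms L unfolding incr_states_def by (cases \<eta>) auto
  then have "partial_sum \<eta> 1 \<noteq> 0" "1 \<in> {1..length \<eta>}"
    by (auto simp: partial_sum_def)
  then show ?thesis
    unfolding local_max_def local_min_def by (meson order_antisym)
qed

text \<open>The mean next step \<open>2 * up \<eta> - 1\<close> is \<open>2 * p - 1\<close> at local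
  maxima, \<open>2 * q - 1\<close> at local minima and 0 elsewhere.\<close>

lemma drift_eq_erg: "drift L p q = erg (\<lambda>\<eta>. 2 * up \<eta> - 1)"
proof -
  let ?\<pi> = "pmf (stationary_dist L p q)"
  have "erg (\<lambda>\<eta>. 2 * up \<eta> - 1) = (\<Sum>\<eta>\<in>S. ?\<pi> \<eta> * (2 * up \<eta> - 1))"
    using stationary_sum_erg[OF stationary_dist] by simp
  also have "\<dots> = (\<Sum>\<eta>\<in>S. (2 * p - 1) * (if local_max \<eta> then ?\<pi> \<eta> else 0)
      + (2 * q - 1) * (if local_min \<eta> then ?\<pi> \<eta> else 0))"
    using not_max_and_min by (intro sum.cong) (auto simp: incr_up_prob_def)
  also have "\<dots> = drift L p q"
    using finite_incr_states unfolding drift_def pi_max_def pi_min_def sum.distrib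
    by (simp add: sum_distrib_left[symmetric] sum.inter_filter)
  finally show ?thesis by simp
qed

end

section \<open>A strong law from second moments\<close>

text \<open>From \<open>s\<^sup>2\<close> to any \<open>n\<close> below the next square there are at
  most \<open>2 * s\<close> steps; they change \<open>z\<close> by at most \<open>2 * C * s\<close>,
  which is small against \<open>s\<^sup>2\<close>.\<close>

lemma tendsto_div_of_squares:
  fixes z :: "nat \<Rightarrow> real"
  assumes step: "\<And>n. \<bar>z (Suc n) - z n\<bar> \<le> C"
    and sq: "(\<lambda>n. z (n\<^sup>2) / real (n\<^sup>2)) \<longlonglongrightarrow> 0"
  shows "(\<lambda>n. z n / real n) \<longlonglongrightarrow> 0"
proof -
  have C: "0 \<le> C" using step[of 0] by linarith
  have diff: "\<bar>z (m + k) - z m\<bar> \<le> C * real k" for m k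
  proof (induction k)
    case (Suc k)
    then show ?case using step[of "m + k"] by (simp add: algebra_simps)
  qed simp
  define b where "b = (\<lambda>s::nat. \<bar>z (s\<^sup>2) / real (s\<^sup>2)\<bar> + 2 * C / real s)"
  have "(\<lambda>s. 2 * C / real s) \<longlonglongrightarrow> 0"
    by (rule lim_const_over_n)
  from tendsto_add_zero[OF tendsto_rabs_zero[OF sq] this] have b: "b \<longlonglongrightarrow> 0"
    unfolding b_def .
  \<comment> \<open>\<open>m\<^sup>2 \<le> n\<close> implies \<open>m \<le> floor_sqrt n\<close>, so
    the root exceeds every bound.\<close>
  have "filterlim floor_sqrt at_top sequentially"
    unfolding filterlim_at_top eventually_sequentially
    by (metis le_floor_sqrtI)
  from filterlim_compose[OF b this] have lim: "(\<lambda>n. b (floor_sqrt n)) \<longlonglongrightarrow> 0" .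
  have "\<bar>z n / real n\<bar> \<le> b (floor_sqrt n)" if "0 < n" for n
  proof -
    define s where "s = floor_sqrt n"
    have s: "s\<^sup>2 \<le> n" "n < (Suc s)\<^sup>2" "0 < s"
      using that Suc_floor_sqrt_power2_gt[of n] by (auto simp: s_def)
    then have n: "n - s\<^sup>2 \<le> 2 * s"
      by (simp add: power2_eq_square)
    have "\<bar>z n\<bar> \<le> \<bar>z (s\<^sup>2)\<bar> + C * real (n - s\<^sup>2)"
      using diff[of "s\<^sup>2" "n - s\<^sup>2"] s by simp
    also have "\<dots> \<le> \<bar>z (s\<^sup>2)\<bar> + C * (2 * real s)"
      using n C by (intro add_left_mono mult_left_mono) linarith+
    finally have "\<bar>z n\<bar> / real n \<le> (\<bar>z (s\<^sup>2)\<bar> + C * (2 * real s)) / real (s\<^sup>2)"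
      using s that C by (intro frac_le) auto
    also have "\<dots> = b s"
      using s by (simp add: b_def add_divide_distrib power2_eq_square)
    finally show ?thesis by (simp add: s_def)
  qed
  then show ?thesis
    by (intro Lim_null_comparison[OF _ lim]) (auto intro!: eventually_sequentiallyI[of 1])
qed

text \<open>Along the squares the normalised second moments are at most
  \<open>(A + B) / m\<^sup>2\<close>. Their sum is finite, so almost surely the series of squared
  quotients converges and its terms tend to 0.\<close>

lemma (in prob_space) slln_second_moment:
  fixes Z :: "nat \<Rightarrow> 'a \<Rightarrow> real"
  assumes [measurable]: "\<And>n. random_variable borel (Z n)"
    and step: "\<And>n. AE \<omega> in M. \<bar>Z (Suc n) \<omega> - Z n \<omega>\<bar> \<le> C"
    and int: "\<And>n. integrable M (\<lambda>\<omega>. (Z n \<omega>)\<^sup>2)"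
    and mom: "\<And>n. expectation (\<lambda>\<omega>. (Z n \<omega>)\<^sup>2) \<le> A + B * real n"
    and nonneg: "0 \<le> A" "0 \<le> B"
  shows "AE \<omega> in M. (\<lambda>n. Z n \<omega> / real n) \<longlonglongrightarrow> 0"
proof -
  \<comment> \<open>The index \<open>Suc n\<close> keeps the denominators positive.\<close>
  define f where "f = (\<lambda>n \<omega>. (Z ((Suc n)\<^sup>2) \<omega> / real ((Suc n)\<^sup>2))\<^sup>2)"
  have fm [measurable]: "f n \<in> borel_measurable M" for n
    unfolding f_def by measurable
  have bound: "(\<integral>\<^sup>+\<omega>. ennreal (f n \<omega>) \<partial>M) \<le> ennreal ((A + B) / real ((Suc n)\<^sup>2))" for n
  proof -
    let ?r = "real ((Suc n)\<^sup>2)"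
    have r: "1 \<le> ?r" by (simp del: of_nat_Suc)
    have f: "f n = (\<lambda>\<omega>. (Z ((Suc n)\<^sup>2) \<omega>)\<^sup>2 / ?r\<^sup>2)"
      unfolding f_def by (simp add: power_divide)
    have "(\<integral>\<^sup>+\<omega>. ennreal (f n \<omega>) \<partial>M) = ennreal (expectation (f n))"
      using int by (intro nn_integral_eq_integral) (auto simp: f)
    also have "expectation (f n) \<le> (A + B * ?r) / ?r\<^sup>2"
      unfolding f using mom[of "(Suc n)\<^sup>2"] by (simp add: divide_right_mono)
    \<comment> \<open>As \<open>?r\<close> is at least 1, the constant \<open>A\<close> is absorbed
      into the linear term.\<close>
    also have "\<dots> \<le> (A * ?r + B * ?r) / ?r\<^sup>2"
      using r nonneg mult_left_mono[OF r nonneg(1)] by (intro divide_right_mono) auto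
    also have "\<dots> = (A + B) / ?r"
      using r by (simp add: power2_eq_square[of ?r] distrib_right[symmetric] del: of_nat_Suc of_nat_power)
    finally show ?thesis by (simp add: ennreal_leI)
  qed
  have "summable (\<lambda>n. (A + B) * inverse (real (Suc n) ^ 2))"
    by (intro summable_mult) (use inverse_power_summable[of 2] in \<open>subst summable_Suc_iff, simp\<close>)
  then have sum: "summable (\<lambda>n. (A + B) / real ((Suc n)\<^sup>2))"
    by (simp add: divide_inverse)
  have "(\<integral>\<^sup>+\<omega>. (\<Sum>n. ennreal (f n \<omega>)) \<partial>M) = (\<Sum>n. \<integral>\<^sup>+\<omega>. ennreal (f n \<omega>) \<partial>M)"
    by (rule nn_integral_suminf) measurable
  also have "\<dots> \<le> (\<Sum>n. ennreal ((A + B) / real ((Suc n)\<^sup>2)))"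
    by (intro suminf_le bound) auto
  also have "\<dots> = ennreal (\<Sum>n. (A + B) / real ((Suc n)\<^sup>2))"
    using nonneg by (intro suminf_ennreal2 sum) auto
  also have "\<dots> < \<infinity>"
    by simp
  finally have "(\<integral>\<^sup>+\<omega>. (\<Sum>n. ennreal (f n \<omega>)) \<partial>M) \<noteq> \<infinity>"
    by simp
  then have "AE \<omega> in M. (\<Sum>n. ennreal (f n \<omega>)) \<noteq> \<infinity>"
    by (intro nn_integral_PInf_AE) auto
  moreover have "AE \<omega> in M. \<forall>n. \<bar>Z (Suc n) \<omega> - Z n \<omega>\<bar> \<le> C"
    using step by (simp add: AE_all_countable)
  ultimately show ?thesis
  proof eventually_elim
    case (elim \<omega>)
    have "summable (\<lambda>n. f n \<omega>)"
      using elim(1) by (intro summable_suminf_not_top) (auto simp: f_def)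
    then have "(\<lambda>n. f n \<omega>) \<longlonglongrightarrow> 0"
      by (rule summable_LIMSEQ_zero)
    then have "(\<lambda>n. \<bar>Z ((Suc n)\<^sup>2) \<omega> / real ((Suc n)\<^sup>2)\<bar>) \<longlonglongrightarrow> 0"
      using tendsto_real_sqrt[of "\<lambda>n. f n \<omega>" 0] by (simp add: f_def)
    then have "(\<lambda>n. Z ((Suc n)\<^sup>2) \<omega> / real ((Suc n)\<^sup>2)) \<longlonglongrightarrow> 0"
      by (rule tendsto_rabs_zero_cancel)
    then have "(\<lambda>n. Z (n\<^sup>2) \<omega> / real (n\<^sup>2)) \<longlonglongrightarrow> 0"
      by (rule LIMSEQ_imp_Suc)
    with elim(2) show ?case
      by (intro tendsto_div_of_squares[of "\<lambda>n. Z n \<omega>" C]) auto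
  qed
qed

text \<open>For positive \<open>n\<close>, \<open>\<bar>x n\<bar>\<close> is \<open>n\<close> times
  a quotient with a positive limit.\<close>

lemma abs_at_top_of_div_tendsto:
  fixes x :: "nat \<Rightarrow> int"
  assumes lim: "(\<lambda>n. real_of_int (x n) / real n) \<longlonglongrightarrow> d" and "d \<noteq> 0"
  shows "filterlim (\<lambda>n. \<bar>x n\<bar>) at_top sequentially"
proof -
  have "(\<lambda>n. \<bar>real_of_int (x n) / real n\<bar>) \<longlonglongrightarrow> \<bar>d\<bar>"
    using lim by (rule tendsto_rabs)
  then have lim': "filterlim (\<lambda>n. \<bar>real_of_int (x n) / real n\<bar> * real n) at_top sequentially"
    using assms(2) by (intro filterlim_tendsto_pos_mult_at_top filterlim_real_sequentially) auto
  have eq: "\<forall>\<^sub>F n in sequentially. \<bar>real_of_int (x n) / real n\<bar> * real n = real_of_int \<bar>x n\<bar>"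
    using eventually_gt_at_top[of 0] by eventually_elim (simp add: abs_divide)
  have "filterlim (\<lambda>n. real_of_int \<bar>x n\<bar>) at_top sequentially"
    using lim' filterlim_cong[OF refl refl eq] by (rule iffD1[rotated])
  then show ?thesis
    unfolding filterlim_at_top by (metis (mono_tags, lifting) eventually_mono of_int_le_iff)
qed

section \<open>The walk and its martingale\<close>

primrec increments :: "(nat \<Rightarrow> int) \<Rightarrow> nat \<Rightarrow> int list" where
  "increments x 0 = []"
| "increments x (Suc n) = (x (Suc n) - x n) # increments x n"

text \<open>Reconstructs the walk started at \<open>0\<close> from its increments, most recent first.\<close>

definition walk_of :: "int list \<Rightarrow> nat \<Rightarrow> int" where
  "walk_of e i = sum_list (drop (length e - i) e)"

lemma length_increments [simp]: "length (increments x n) = n"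
  by (induction n) auto

lemma sum_list_increments: "sum_list (increments x n) = x n - x 0"
  by (induction n) auto

lemma walk_of_length: "walk_of e (length e) = sum_list e"
  by (simp add: walk_of_def)

lemma walk_of_Cons: "i \<le> length e \<Longrightarrow> walk_of (a # e) i = walk_of e i"
  by (simp add: walk_of_def Suc_diff_le)

text \<open>Turns an event about increments into the event about positions on which
  \<open>step_up\<close> and \<open>step_down\<close> condition.\<close>

lemma increments_eq_iff:
  assumes "x 0 = 0" "length e = n"
  shows "increments x n = e \<longleftrightarrow> (\<forall>i\<le>n. x i = walk_of e i)"
  using assms(2)
proof (induction n arbitrary: e)
  case 0
  then show ?case using assms(1) by (simp add: walk_of_def)
next
  case (Suc n)
  obtain a e' where e: "e = a # e'" "length e' = n"
    using Suc.prems by (auto simp: length_Suc_conv)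
  have last: "walk_of e (Suc n) = a + walk_of e' n"
    using walk_of_length[of e] walk_of_length[of e'] e by simp
  have init: "(\<forall>i\<le>n. x i = walk_of e i) \<longleftrightarrow> (\<forall>i\<le>n. x i = walk_of e' i)"
    using walk_of_Cons[of _ e' a] e by auto
  have all_le_Suc: "(\<forall>i\<le>Suc n. Q i) \<longleftrightarrow> (\<forall>i\<le>n. Q i) \<and> Q (Suc n)" for Q
    by (auto simp: le_Suc_eq)
  have "increments x (Suc n) = e \<longleftrightarrow> x (Suc n) = a + x n \<and> (\<forall>i\<le>n. x i = walk_of e' i)"
    unfolding e(1) increments.simps list.inject Suc.IH[OF e(2)] diff_eq_eq ..
  also have "\<dots> \<longleftrightarrow> (\<forall>i\<le>n. x i = walk_of e' i) \<and> x (Suc n) = a + walk_of e' n"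
    by (metis order_refl)
  finally show ?case
    unfolding all_le_Suc last init .
qed

text \<open>The position minus that of \<open>m\<close> steps ago is the sum of the newest
  \<open>m\<close> increments, so extremality in the window is a sign condition on partial sums. The
  hypothesis \<open>nz\<close> rules out the first branch of \<open>walk_up_prob\<close>.\<close>

lemma walk_up_prob_walk_of:
  assumes e: "length e = n" "L \<le> n" and nz: "\<not> (local_max (take L e) \<and> local_min (take L e))"
  shows "walk_up_prob L p q (walk_of e) n = incr_up_prob p q (take L e)"
proof -
  let ?R = "recent L (walk_of e) n"
  have R: "?R = (\<lambda>m. sum_list e - sum_list (take m e)) ` {0..L}"
  proof -
    have "walk_of e (n - m) = sum_list e - sum_list (take m e)" if "m \<le> L" for m
      using that e sum_list_append[of "take m e" "drop m e"] by (simp add: walk_of_def)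
    then show ?thesis
      unfolding recent_def using e by (intro image_cong) auto
  qed
  have n: "walk_of e n = sum_list e"
    using walk_of_length[of e] e by simp
  have fin: "finite ?R" "?R \<noteq> {}" and mem: "walk_of e n \<in> ?R"
    unfolding R n by (auto intro!: image_eqI[of _ _ 0])
  \<comment> \<open>The window starts at 0, the partial sums at 1; the empty sum satisfies both sign
    conditions.\<close>
  have zero_to_L: "{0..L} = insert 0 {1..L}" by auto
  have len: "length (take L e) = L" using e by simp
  have part: "partial_sum (take L e) j = sum_list (take j e)" if "j \<le> L" for j
    using that by (simp add: partial_sum_def min.absorb1)
  have "walk_of e n = Max ?R \<longleftrightarrow> (\<forall>m\<in>{0..L}. 0 \<le> sum_list (take m e))"
    using mem unfolding eq_Max_iff[OF fin] by (auto simp: R n)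
  also have "\<dots> \<longleftrightarrow> local_max (take L e)"
    unfolding local_max_def len zero_to_L by (simp add: part)
  finally have max: "walk_of e n = Max ?R \<longleftrightarrow> local_max (take L e)" .
  have "walk_of e n = Min ?R \<longleftrightarrow> (\<forall>m\<in>{0..L}. sum_list (take m e) \<le> 0)"
    using mem unfolding eq_Min_iff[OF fin] by (auto simp: R n)
  also have "\<dots> \<longleftrightarrow> local_min (take L e)"
    unfolding local_min_def len zero_to_L by (simp add: part)
  finally have min: "walk_of e n = Min ?R \<longleftrightarrow> local_min (take L e)" .
  show ?thesis
    unfolding walk_up_prob_def incr_up_prob_def max min using nz by auto
qed

section \<open>The law of the increments and the martingale of the walk\<close>

locale centred_walk = perturbed_walk M L p q X + incr_chain L p q
  for M :: "'a measure" and L :: nat and p q :: real and X :: "nat \<Rightarrow> 'a \<Rightarrow> int" +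
  assumes start: "AE \<omega> in M. X 0 \<omega> = 0"
begin

abbreviation E :: "nat \<Rightarrow> 'a \<Rightarrow> int list" where
  "E n \<omega> \<equiv> increments (\<lambda>i. X i \<omega>) n"

abbreviation P :: "nat \<Rightarrow> int list \<Rightarrow> real" where
  "P n e \<equiv> \<P>(\<omega> in M. E n \<omega> = e)"

text \<open>Uses the full history, so it also makes sense before time \<open>L\<close>.\<close>

abbreviation w :: "int list \<Rightarrow> real" where
  "w e \<equiv> walk_up_prob L p q (walk_of e) (length e)"

lemmas [measurable] = X_measurable

lemma E_measurable [measurable]: "E n \<in> measurable M (count_space UNIV)"
proof (induction n)
  case (Suc n)
  \<comment> \<open>The two positions are first frozen as constants, then restored one by one; this
    works as \<open>int\<close> is countable.\<close>
  have "(\<lambda>\<omega>. (a - b) # E n \<omega>) \<in> measurable M (count_space UNIV)" for a b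
    by (rule measurable_compose[OF Suc]) simp
  then have "(\<lambda>\<omega>. (a - X n \<omega>) # E n \<omega>) \<in> measurable M (count_space UNIV)" for a
    by (rule measurable_compose_countable[OF _ X_measurable])
  then have "(\<lambda>\<omega>. (X (Suc n) \<omega> - X n \<omega>) # E n \<omega>) \<in> measurable M (count_space UNIV)"
    by (rule measurable_compose_countable[OF _ X_measurable])
  then show ?case by (simp only: increments.simps)
qed simp

text \<open>The conditional step probabilities as a multiplication rule, valid for null histories as
  well.\<close>

lemma prob_Cons:
  assumes e: "e \<in> incr_states n"
  shows "P (Suc n) (1 # e) = P n e * w e" "P (Suc n) (- 1 # e) = P n e * (1 - w e)"
proof -
  let ?Q = "\<lambda>\<omega>. \<forall>i\<le>n. X i \<omega> = walk_of e i"
  have len: "length e = n" using e by (simp add: incr_states_def)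
  have Q [measurable]: "Measurable.pred M ?Q" by measurable
  \<comment> \<open>The start at 0 is only almost sure, so the events agree up to a null
    set.\<close>
  have Pn: "P n e = \<P>(\<omega> in M. ?Q \<omega>)"
  proof (rule finite_measure_eq_AE)
    show "AE \<omega> in M. \<omega> \<in> {\<omega> \<in> space M. E n \<omega> = e} \<longleftrightarrow> \<omega> \<in> {\<omega> \<in> space M. ?Q \<omega>}"
      using start
    proof eventually_elim
      case (elim \<omega>)
      have "E n \<omega> = e \<longleftrightarrow> ?Q \<omega>"
        using elim len by (rule increments_eq_iff)
      then show ?case by blast
    qed
  qed measurable
  have Ps: "P (Suc n) (s # e) = \<P>(\<omega> in M. X (Suc n) \<omega> = walk_of e n + s \<and> ?Q \<omega>)" for s
  proof (rule finite_measure_eq_AE)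
    show "AE \<omega> in M. \<omega> \<in> {\<omega> \<in> space M. E (Suc n) \<omega> = s # e} \<longleftrightarrow>
        \<omega> \<in> {\<omega> \<in> space M. X (Suc n) \<omega> = walk_of e n + s \<and> ?Q \<omega>}"
      using start
    proof eventually_elim
      case (elim \<omega>)
      have E: "E n \<omega> = e \<longleftrightarrow> ?Q \<omega>"
        using elim len by (rule increments_eq_iff)
      show ?case
      proof (cases "?Q \<omega>")
        case True
        then have "X n \<omega> = walk_of e n" by blast
        moreover have "E n \<omega> = e" using True E by blast
        ultimately show ?thesis using True by (simp add: diff_eq_eq add.commute)
      next
        case False
        moreover have "E n \<omega> \<noteq> e" using False E by blast
        ultimately show ?thesis by simp
      qed
    qed
  qed measurable
  have Pm: "P (Suc n) (- 1 # e) = \<P>(\<omega> in M. X (Suc n) \<omega> = walk_of e n - 1 \<and> ?Q \<omega>)"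
    unfolding Ps diff_conv_add_uminus ..
  have both: "P (Suc n) (1 # e) = P n e * w e \<and> P (Suc n) (- 1 # e) = P n e * (1 - w e)"
  proof (cases "\<P>(\<omega> in M. ?Q \<omega>) > 0")
    case True
    have solve: "a / c = u \<Longrightarrow> 0 < c \<Longrightarrow> a = c * u" for a c u :: real
      by (simp add: field_simps)
    show ?thesis
      unfolding Pn Pm Ps len
      using solve[OF step_up[OF True, unfolded cond_prob_def] True]
        solve[OF step_down[OF True, unfolded cond_prob_def] True]
      by (rule conjI)
  next
    case False
    \<comment> \<open>On a null history the step assumptions are silent, but the longer event is
      contained in the null one and both sides vanish.\<close>
    have 0: "\<P>(\<omega> in M. ?Q \<omega>) = 0"
      using False[unfolded not_less] measure_nonneg by (rule order_antisym)
    have "\<P>(\<omega> in M. X (Suc n) \<omega> = walk_of e n + s \<and> ?Q \<omega>) \<le> \<P>(\<omega> in M. ?Q \<omega>)" for s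
      by (rule finite_measure_mono, blast, measurable)
    then have null: "P (Suc n) (s # e) = 0" for s
      unfolding Ps 0 using measure_nonneg by (rule order_antisym)
    show ?thesis
      unfolding Pn 0 mult_zero_left using null[of 1] null[of "-1"] by (rule conjI)
  qed
  from both show "P (Suc n) (1 # e) = P n e * w e" by (rule conjunct1)
  from both show "P (Suc n) (- 1 # e) = P n e * (1 - w e)" by (rule conjunct2)
qed

text \<open>The tower rule: average over the last step first.\<close>

lemma sum_P_Suc:
  "(\<Sum>e\<in>incr_states (Suc n). F e * P (Suc n) e) =
    (\<Sum>e\<in>incr_states n. (w e * F (1 # e) + (1 - w e) * F (- 1 # e)) * P n e)"
  unfolding sum_incr_states_Suc
  by (intro sum.cong refl) (simp add: prob_Cons algebra_simps del: increments.simps)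

lemma sum_P: "(\<Sum>e\<in>incr_states n. P n e) = 1"
proof (induction n)
  case 0
  then show ?case by (simp add: incr_states_0 prob_space)
next
  case (Suc n)
  then show ?case using sum_P_Suc[of "\<lambda>_. 1" n] by simp
qed

text \<open>The finitely many histories with steps \<open>+1\<close> and \<open>-1\<close> already
  carry mass 1, by \<open>sum_P\<close>.\<close>

lemma AE_E: "AE \<omega> in M. E n \<omega> \<in> incr_states n"
proof -
  have "\<P>(\<omega> in M. E n \<omega> \<in> incr_states n) = prob (\<Union>e\<in>incr_states n. {\<omega> \<in> space M. E n \<omega> = e})"
    by (intro arg_cong[of _ _ prob]) auto
  also have "\<dots> = 1"
    using finite_incr_states sum_P by (subst finite_measure_finite_Union) (auto simp: disjoint_family_on_def)
  finally show ?thesis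
    by (subst (asm) prob_Collect_eq_1) auto
qed

text \<open>Up to a null set \<open>E n\<close> takes finitely many values, so any \<open>F\<close>
  is integrable and its mean is a finite sum.\<close>

lemma expectation_E:
  fixes F :: "int list \<Rightarrow> real"
  shows "integrable M (\<lambda>\<omega>. F (E n \<omega>))"
    and "expectation (\<lambda>\<omega>. F (E n \<omega>)) = (\<Sum>e\<in>incr_states n. F e * P n e)"
proof -
  let ?f = "\<lambda>\<omega>. \<Sum>e\<in>incr_states n. F e * indicator {\<omega> \<in> space M. E n \<omega> = e} \<omega>"
  have eq: "AE \<omega> in M. F (E n \<omega>) = ?f \<omega>"
    using AE_E[of n] AE_space
  proof eventually_elim
    case (elim \<omega>)
    have "?f \<omega> = (\<Sum>e\<in>incr_states n. if e = E n \<omega> then F e else 0)"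
      using elim(2) by (intro sum.cong) (auto simp: indicator_def)
    then show ?case using elim(1) finite_incr_states by simp
  qed
  have [measurable]: "(\<lambda>\<omega>. F (E n \<omega>)) \<in> borel_measurable M"
    by (rule measurable_compose[OF E_measurable]) simp
  have int: "integrable M (\<lambda>\<omega>. F e * indicator {\<omega> \<in> space M. E n \<omega> = e} \<omega> :: real)" for e
    by (intro integrable_mult_right integrable_real_indicator) (auto simp: emeasure_eq_measure)
  show "integrable M (\<lambda>\<omega>. F (E n \<omega>))"
    by (rule integrable_cong_AE_imp[of M ?f]) (use eq int in auto)
  have "expectation (\<lambda>\<omega>. F (E n \<omega>)) = expectation ?f"
    by (rule integral_cong_AE) (use eq in auto)
  also have "\<dots> = (\<Sum>e\<in>incr_states n. F e * P n e)"
    using int by (subst Bochner_Integration.integral_sum) auto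
  finally show "expectation (\<lambda>\<omega>. F (E n \<omega>)) = (\<Sum>e\<in>incr_states n. F e * P n e)" .
qed

text \<open>The value 0 outside \<open>S\<close> keeps \<open>G\<close> bounded everywhere and makes
  \<open>mart\<close> meaningful for lists shorter than \<open>L\<close>.\<close>

definition G :: "int list \<Rightarrow> real" where
  "G \<eta> = (if \<eta> \<in> S then poisson (\<lambda>\<eta>. 2 * up \<eta> - 1) \<eta> else 0)"

definition G_bound :: real where
  "G_bound = (\<Sum>\<eta>\<in>S. \<bar>G \<eta>\<bar>)"

text \<open>On increment lists of length \<open>n \<ge> L\<close> this is
  \<open>X n - n * drift + poisson (Y n)\<close>, a martingale by the Poisson equation.\<close>

definition mart :: "int list \<Rightarrow> real" where
  "mart e = of_int (sum_list e) - drift L p q * real (length e) + G (take L e)"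

text \<open>Bounds one increment of \<open>mart\<close>: the step, the drift and two values of
  \<open>G\<close>.\<close>

definition K :: real where "K = 1 + \<bar>drift L p q\<bar> + 2 * G_bound"

lemma abs_G_le: "\<bar>G \<eta>\<bar> \<le> G_bound"
proof (cases "\<eta> \<in> S")
  case True
  then show ?thesis
    unfolding G_bound_def using finite_incr_states by (intro member_le_sum) auto
next
  case False
  then show ?thesis
    unfolding G_bound_def by (simp add: G_def[of \<eta>] sum_nonneg)
qed

lemma mart_step_bound:
  assumes "s \<in> {-1, 1}"
  shows "\<bar>mart (s # e) - mart e\<bar> \<le> K"
proof -
  let ?a = "G (take L (s # e))" and ?b = "G (take L e)"
  have tri: "\<bar>x - y + a - b\<bar> \<le> \<bar>x\<bar> + \<bar>y\<bar> + 2 * g" if "\<bar>a\<bar> \<le> g" "\<bar>b\<bar> \<le> g" for x y a b g :: real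
    using that by linarith
  have "mart (s # e) - mart e = of_int s - drift L p q + ?a - ?b"
    by (simp add: mart_def algebra_simps)
  also have "\<bar>\<dots>\<bar> \<le> \<bar>of_int s\<bar> + \<bar>drift L p q\<bar> + 2 * G_bound"
    using abs_G_le abs_G_le by (rule tri)
  also have "\<bar>of_int s :: real\<bar> = 1"
    using assms by auto
  finally show ?thesis
    unfolding K_def .
qed

lemma mart_bound:
  assumes "e \<in> incr_states n"
  shows "\<bar>mart e\<bar> \<le> (1 + \<bar>drift L p q\<bar>) * real n + G_bound"
proof -
  have abs_sum: "\<bar>sum_list e\<bar> \<le> int (length e)" if "set e \<subseteq> {-1, 1}" for e :: "int list"
    using that by (induction e) auto
  have tri: "\<bar>x - d * m + a\<bar> \<le> (1 + \<bar>d\<bar>) * m + g" if "\<bar>x\<bar> \<le> m" "\<bar>a\<bar> \<le> g" for x d m a g :: real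
  proof -
    have "\<bar>d * m\<bar> = \<bar>d\<bar> * m"
      using that(1) by (simp add: abs_mult)
    with that show ?thesis
      unfolding distrib_right by linarith
  qed
  have "set e \<subseteq> {-1, 1}" and n: "length e = n"
    using assms by (auto simp: incr_states_def)
  from abs_sum[OF this(1)] have "\<bar>real_of_int (sum_list e)\<bar> \<le> real n"
    unfolding n by linarith
  then show ?thesis
    unfolding mart_def n using abs_G_le by (rule tri)
qed

lemma take_in_S: "e \<in> incr_states n \<Longrightarrow> L \<le> n \<Longrightarrow> take L e \<in> S"
  by (auto simp: incr_states_def dest: in_set_takeD)

text \<open>From time \<open>L\<close> on the history matters only through the state of the
  increment chain.\<close>

lemma w_eq_up: "e \<in> incr_states n \<Longrightarrow> L \<le> n \<Longrightarrow> w e = up (take L e)"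
  using walk_up_prob_walk_of[of e "length e" L p q] not_max_and_min[OF take_in_S]
  by (auto simp: incr_states_def)

text \<open>The mean step \<open>2 * up \<eta> - 1\<close> minus the drift cancels against the mean
  change of \<open>G\<close>, by the Poisson equation.\<close>

lemma mart_mean:
  assumes e: "e \<in> incr_states n" and n: "L \<le> n"
  shows "w e * mart (1 # e) + (1 - w e) * mart (- 1 # e) = mart e"
proof -
  let ?f = "\<lambda>\<eta>. 2 * up \<eta> - 1" and ?\<eta> = "take L e"
  have len: "length e = n" using e by (simp add: incr_states_def)
  have \<eta>: "?\<eta> \<in> S" using take_in_S[OF e n] .
  \<comment> \<open>Prepending a step drops the oldest increment, as in the chain.\<close>
  have take: "take L (s # e) = s # butlast ?\<eta>" for s
    using L n len by (cases L) (auto simp: butlast_take)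
  have "w e * mart (1 # e) + (1 - w e) * mart (- 1 # e)
      = of_int (sum_list e) + ?f ?\<eta> - drift L p q * (real n + 1) + T G ?\<eta>"
    unfolding w_eq_up[OF e n] mart_def take T_def by (simp add: len algebra_simps)
  also have "T G ?\<eta> = T (poisson ?f) ?\<eta>"
    unfolding T_def G_def using shift_in_S[OF _ \<eta>] by simp
  also have "\<dots> = G ?\<eta> - ?f ?\<eta> + drift L p q"
    using poisson_equation[OF \<eta>, of ?f] \<eta> by (simp add: G_def drift_eq_erg)
  finally show ?thesis
    by (simp add: mart_def len algebra_simps)
qed

text \<open>Since the increment has conditional mean 0, the cross term vanishes; only its mean
  square is added.\<close>

lemma second_moment_step:
  assumes "L \<le> n"
  shows "expectation (\<lambda>\<omega>. (mart (E (Suc n) \<omega>))\<^sup>2) \<le> expectation (\<lambda>\<omega>. (mart (E n \<omega>))\<^sup>2) + K\<^sup>2"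
proof -
  have "w e * (mart (1 # e))\<^sup>2 + (1 - w e) * (mart (- 1 # e))\<^sup>2 \<le> (mart e)\<^sup>2 + K\<^sup>2"
    if e: "e \<in> incr_states n" for e
  proof -
    define m u d d' where "m = mart e" and "u = w e" and "d = mart (1 # e) - m" and "d' = mart (- 1 # e) - m"
    have mean: "u * d + (1 - u) * d' = 0"
      using mart_mean[OF e assms] unfolding m_def u_def d_def d'_def by (simp add: algebra_simps)
    have u: "0 \<le> u" "u \<le> 1"
      using up_bounds unfolding u_def w_eq_up[OF e assms] by auto
    have d: "d\<^sup>2 \<le> K\<^sup>2" "d'\<^sup>2 \<le> K\<^sup>2"
      using mart_step_bound[of 1 e] mart_step_bound[of "-1" e] unfolding d_def d'_def m_def
      by (auto intro: power2_le_iff_abs_le[THEN iffD2] dest: order_trans[OF abs_ge_zero])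
    have "u * (m + d)\<^sup>2 + (1 - u) * (m + d')\<^sup>2
        = m\<^sup>2 + 2 * m * (u * d + (1 - u) * d') + (u * d\<^sup>2 + (1 - u) * d'\<^sup>2)"
      by (simp add: power2_eq_square algebra_simps)
    also have "\<dots> \<le> m\<^sup>2 + (u * K\<^sup>2 + (1 - u) * K\<^sup>2)"
      unfolding mean using u d by (simp add: add_mono mult_left_mono)
    finally show ?thesis
      by (simp add: m_def u_def d_def d'_def algebra_simps)
  qed
  then have "(\<Sum>e\<in>incr_states (Suc n). (mart e)\<^sup>2 * P (Suc n) e) \<le> (\<Sum>e\<in>incr_states n. ((mart e)\<^sup>2 + K\<^sup>2) * P n e)"
    unfolding sum_P_Suc by (intro sum_mono mult_right_mono) auto
  also have "\<dots> = (\<Sum>e\<in>incr_states n. (mart e)\<^sup>2 * P n e) + K\<^sup>2"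
    by (simp add: distrib_right sum.distrib sum_distrib_left[symmetric] sum_P)
  finally show ?thesis
    unfolding expectation_E(2)[of "\<lambda>e. (mart e)\<^sup>2"] .
qed

text \<open>Up to time \<open>L\<close> the deterministic bound \<open>mart_bound\<close> is used;
  afterwards each step adds at most \<open>K\<^sup>2\<close>.\<close>

lemma second_moment:
  "expectation (\<lambda>\<omega>. (mart (E n \<omega>))\<^sup>2) \<le> ((1 + \<bar>drift L p q\<bar>) * real L + G_bound)\<^sup>2 + K\<^sup>2 * real n"
    (is "?a n \<le> ?A + _")
proof -
  have early: "?a n \<le> ?A" if "n \<le> L" for n
  proof -
    have "(mart e)\<^sup>2 \<le> ?A" if "e \<in> incr_states n" for e
    proof -
      have "\<bar>mart e\<bar> \<le> (1 + \<bar>drift L p q\<bar>) * real n + G_bound"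
        using mart_bound[OF that] .
      also have "\<dots> \<le> (1 + \<bar>drift L p q\<bar>) * real L + G_bound"
        using \<open>n \<le> L\<close> by (intro add_right_mono mult_left_mono) auto
      finally show ?thesis
        by (metis abs_ge_zero power2_abs power_mono)
    qed
    then have "?a n \<le> (\<Sum>e\<in>incr_states n. ?A * P n e)"
      unfolding expectation_E(2)[of "\<lambda>e. (mart e)\<^sup>2"] by (intro sum_mono mult_right_mono) auto
    also have "\<dots> = ?A"
      by (simp add: sum_distrib_left[symmetric] sum_P)
    finally show ?thesis .
  qed
  show ?thesis
  proof (induction n)
    case 0
    show ?case using early[of 0] by simp
  next
    case (Suc n)
    show ?case
    proof (cases "L \<le> n")
      case True
      then show ?thesis
        using Suc second_moment_step[OF True] by (simp add: distrib_left)
    next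
      case False
      then have "?a (Suc n) \<le> ?A" by (intro early) simp
      then show ?thesis by (rule order_trans) simp
    qed
  qed
qed

lemma strong_law: "AE \<omega> in M. (\<lambda>n. real_of_int (X n \<omega>) / real n) \<longlonglongrightarrow> drift L p q"
proof -
  have "AE \<omega> in M. (\<lambda>n. mart (E n \<omega>) / real n) \<longlonglongrightarrow> 0"
  proof (rule slln_second_moment[where Z = "\<lambda>n \<omega>. mart (E n \<omega>)" and C = K and B = "K\<^sup>2"
        and A = "((1 + \<bar>drift L p q\<bar>) * real L + G_bound)\<^sup>2"])
    show "random_variable borel (\<lambda>\<omega>. mart (E n \<omega>))" for n
      by (rule measurable_compose[OF E_measurable]) simp
    show "AE \<omega> in M. \<bar>mart (E (Suc n) \<omega>) - mart (E n \<omega>)\<bar> \<le> K" for n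
      \<comment> \<open>At \<open>Suc n\<close> this also says that the newest increment is
        \<open>+1\<close> or \<open>-1\<close>.\<close>
      using AE_E[of "Suc n"]
      by eventually_elim (simp add: incr_states_Cons mart_step_bound)
    show "integrable M (\<lambda>\<omega>. (mart (E n \<omega>))\<^sup>2)" for n
      by (rule expectation_E(1))
    show "expectation (\<lambda>\<omega>. (mart (E n \<omega>))\<^sup>2)
        \<le> ((1 + \<bar>drift L p q\<bar>) * real L + G_bound)\<^sup>2 + K\<^sup>2 * real n" for n
      by (rule second_moment)
  qed auto
  then show ?thesis
    using start
  proof eventually_elim
    case (elim \<omega>)
    have "(\<lambda>n. G (take L (E n \<omega>)) / real n) \<longlonglongrightarrow> 0"
    proof (rule Lim_null_comparison)
      show "\<forall>\<^sub>F n in sequentially. norm (G (take L (E n \<omega>)) / real n) \<le> G_bound / real n"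
        using abs_G_le by (auto intro!: always_eventually divide_right_mono)
      show "(\<lambda>n. G_bound / real n) \<longlonglongrightarrow> 0"
        by (rule lim_const_over_n)
    qed
    from tendsto_diff[OF tendsto_add[OF elim(1) tendsto_const[of "drift L p q"]] this]
    have "(\<lambda>n. mart (E n \<omega>) / real n + drift L p q - G (take L (E n \<omega>)) / real n) \<longlonglongrightarrow> drift L p q"
      by simp
    \<comment> \<open>At \<open>n = 0\<close> all quotients are 0 but the drift remains, so equality
      is claimed only for positive \<open>n\<close>.\<close>
    moreover have "\<forall>\<^sub>F n in sequentially. mart (E n \<omega>) / real n + drift L p q - G (take L (E n \<omega>)) / real n
        = real_of_int (X n \<omega>) / real n"
      using eventually_gt_at_top[of 0]
      by eventually_elim (use elim(2) in \<open>simp add: mart_def sum_list_increments field_simps\<close>)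
    ultimately show ?case
      by (rule Lim_transform_eventually)
  qed
qed

end

theorem lemma1:
  fixes M :: "'a measure" and X :: "nat \<Rightarrow> 'a \<Rightarrow> int" and L :: nat and p q :: real
  assumes "0 < p" "p < 1" and "0 < q" "q < 1" and "L \<ge> 1"
    and "perturbed_walk M L p q X"
    and "AE \<omega> in M. X 0 \<omega> = 0"
  shows "(AE \<omega> in M. (\<lambda>n. real_of_int (X n \<omega>) / real n) \<longlonglongrightarrow> drift L p q) \<and>
    (drift L p q \<noteq> 0 \<longrightarrow> (AE \<omega> in M. filterlim (\<lambda>n. \<bar>X n \<omega>\<bar>) at_top sequentially))"
proof -
  interpret perturbed_walk M L p q X by fact
  interpret centred_walk M L p q X
    using assms by unfold_locales auto
  have "AE \<omega> in M. filterlim (\<lambda>n. \<bar>X n \<omega>\<bar>) at_top sequentially" if "drift L p q \<noteq> 0"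
    using strong_law by eventually_elim (rule abs_at_top_of_div_tendsto[OF _ that])
  with strong_law show ?thesis by blast
qed

end
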